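(* For each $n \ge 0$, let $a_n$ denote the number of involutions of length $n$ that avoid the pattern $3421$. Then the (ordinary) generating function of this sequence is \[ \sum_{n\ge 0} a_n x^n \;=\; \frac{2-5x+x^{2}-2x^{3}+x(1-x)\sqrt{1-4x^{2}}}{2(1-x)(1-2x-x^{2}-2x^{3})}, \] as an identity of formal power series in $x$, where $\sqrt{1-4x^2}$ denotes the formal power series square root with constant term $1$.
   Context: A permutation of length $n$ is a bijection $\pi$ from $\{1,\dots,n\}$ to itself, written in one-line notation $\pi=\pi(1)\pi(2)\cdots\pi(n)$. It is an involution if $\pi=\pi^{-1}$, i.e. $\pi(\pi(i))=i$ for all $i$. The unique (empty) permutation of length $0$ counts as an involution, so $a_0=1$. A permutation $\pi$ of length $n$ contains a permutation $\sigma$ of length $k$ as a pattern if there exist indices $1\le i_1<i_2<\cdots<i_k\le n$ such that, for all $a,b\in\{1,\dots,k\}$, $\pi(i_a)<\pi(i_b)$ if and only if $\sigma(a)<\sigma(b)$. Otherwise $\pi$ avoids $\sigma$. Here $3421$ denotes the permutation $\sigma$ of length $4$ with $\sigma(1)=3$, $\sigma(2)=4$, $\sigma(3)=2$, $\sigma(4)=1$. *)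

theory Defs
  imports
    "HOL-Computational_Algebra.Formal_Power_Series"
    "HOL-Combinatorics.Permutations"
begin

definition involutions :: "nat \<Rightarrow> (nat \<Rightarrow> nat) set" where
  "involutions n = {\<pi>. \<pi> permutes {1..n} \<and> (\<forall>i\<in>{1..n}. \<pi> (\<pi> i) = i)}"

text \<open>Only the values of \<open>\<pi>\<close> on \<open>{1..n}\<close> and of \<open>\<sigma>\<close> on \<open>{1..k}\<close> matter; \<open>f a\<close> is the index \<open>i\<^sub>a\<close>.\<close>

definition contains_pattern :: "nat \<Rightarrow> (nat \<Rightarrow> nat) \<Rightarrow> nat \<Rightarrow> (nat \<Rightarrow> nat) \<Rightarrow> bool" where
  "contains_pattern n \<pi> k \<sigma> \<longleftrightarrow>
     (\<exists>f :: nat \<Rightarrow> nat. strict_mono_on {1..k} f \<and> f ` {1..k} \<subseteq> {1..n} \<and>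
        (\<forall>a\<in>{1..k}. \<forall>b\<in>{1..k}. \<pi> (f a) < \<pi> (f b) \<longleftrightarrow> \<sigma> a < \<sigma> b))"

abbreviation avoids_pattern :: "nat \<Rightarrow> (nat \<Rightarrow> nat) \<Rightarrow> nat \<Rightarrow> (nat \<Rightarrow> nat) \<Rightarrow> bool" where
  "avoids_pattern n \<pi> k \<sigma> \<equiv> \<not> contains_pattern n \<pi> k \<sigma>"

definition perm3421 :: "nat \<Rightarrow> nat" where
  "perm3421 = id(1 := 3, 2 := 4, 3 := 2, 4 := 1)"

lemma perm3421_permutes: "perm3421 permutes {1..4}"
proof -
  have S: "{1..4} = {1, 2, 3, 4::nat}"
    by auto
  have "bij_betw perm3421 {1..4} {1..4}"
    unfolding S by (auto simp: bij_betw_def perm3421_def)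
  then show ?thesis
    by (rule bij_imp_permutes) (auto simp: perm3421_def)
qed

definition num_avoiding_involutions :: "nat \<Rightarrow> nat" where
  "num_avoiding_involutions n = card {\<pi> \<in> involutions n. avoids_pattern n \<pi> 4 perm3421}"

definition sqrt_series :: "real fps" where
  "sqrt_series = fps_radical root 2 (1 - 4 * fps_X ^ 2)"

text \<open>The choice of \<open>root\<close> for the constant term selects the square root with constant term 1.\<close>

lemma sqrt_series_square: "sqrt_series ^ 2 = 1 - 4 * fps_X ^ 2"
  unfolding sqrt_series_def
  using power_radical[of "1 - 4 * fps_X ^ 2 :: real fps" root 1]
  by (simp add: numeral_2_eq_2 fps_numeral_fps_const)

lemma sqrt_series_nth_0: "fps_nth sqrt_series 0 = 1"
  by (simp add: sqrt_series_def numeral_2_eq_2)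

end

theory Submission
  imports Defs
begin

text \<open>
The enumeration removes the cycle through \<open>1\<close>. Let \<open>\<pi>\<close> be an involution that avoids \<open>3421\<close>, and suppose
that \<open>\<pi> 1 = k > 1\<close>. An entry above \<open>k\<close> in one of the positions \<open>2, \<dots>, k - 1\<close> cannot be followed there by an
entry below \<open>k\<close>: together with the values \<open>k\<close> in position \<open>1\<close> and \<open>1\<close> in position \<open>k\<close>, the two entries would
form \<open>3421\<close>. So \<open>r\<close> positions with small values come first, and these are mapped to themselves; the
remaining \<open>m = k - 2 - r\<close> positions have values above \<open>k\<close>. The small part avoids \<open>231\<close>, since the value \<open>1\<close>
comes after it, and an involution without \<open>231\<close> is layered, i.e. a direct sum of decreasing
permutations. The large values are increasing: if positions \<open>i < j < k\<close> had values \<open>\<pi> i > \<pi> j > k\<close>, then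
the positions \<open>1 < i < \<pi> j < \<pi> i\<close> would carry \<open>k, \<pi> i, j, i\<close>, again \<open>3421\<close>.

Deleting \<open>1\<close>, \<open>k\<close> and the layered part leaves an avoiding involution \<open>\<rho>\<close> that is increasing on its first
\<open>m\<close> positions and maps them beyond position \<open>m\<close>. Conversely every layered involution and every
such \<open>\<rho>\<close> can be put back (\<open>bij_betw_first_cycle_class\<close>). So the right quantity is the number
\<open>num_increasing n m\<close> of avoiding involutions of length \<open>n\<close> that are increasing on \<open>{1..m}\<close> and map
\<open>{1..m}\<close> outside itself; \<open>m = 0\<close> gives the sequence of the theorem. It can be computed recursively,
because the same property is easily read off from \<open>(r, m)\<close>: it holds for \<open>\<pi>\<close> and a given \<open>m' \<ge> 2\<close> if and
only if \<open>r = 0\<close> and \<open>m' \<le> m + 1\<close>, and for \<open>m' = 1\<close> whenever \<open>\<pi> 1 \<noteq> 1\<close>.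

Let \<open>H\<^sub>m\<close> be the generating function of \<open>num_increasing n m\<close> in \<open>n\<close>, and let \<open>L = (1 - x) / (1 - 2x)\<close> be that of
layered involutions. The recursion becomes
\<open>H\<^sub>0 = 1 + x H\<^sub>0 + H\<^sub>1\<close>, \<open>H\<^sub>1 = L (x\<^sup>2 H\<^sub>0 + H\<^sub>2)\<close>, and \<open>H\<^sub>m = H\<^sub>m\<^sub>+\<^sub>1 + x\<^sup>2 H\<^sub>m\<^sub>-\<^sub>1\<close> for \<open>m \<ge> 2\<close>.
The characteristic roots of the last equation are \<open>(1 \<plusminus> \<surd>(1 - 4x\<^sup>2)) / 2\<close>. Since the order of \<open>H\<^sub>m\<close> grows with \<open>m\<close>, only the
root without constant term contributes, so that \<open>H\<^sub>2\<close> is this root times \<open>H\<^sub>1\<close> (\<open>increasing_gf_2\<close>). Three linear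
equations for \<open>H\<^sub>0\<close>, \<open>H\<^sub>1\<close>, \<open>H\<^sub>2\<close> remain, and clearing the square root from the denominator of the
solution gives the stated formula.
\<close>

section \<open>Avoiding involutions of a finite set of naturals\<close>

definition has_3421 :: "nat set \<Rightarrow> (nat \<Rightarrow> nat) \<Rightarrow> bool" where
  "has_3421 S \<pi> \<longleftrightarrow> (\<exists>a\<in>S. \<exists>b\<in>S. \<exists>c\<in>S. \<exists>d\<in>S. a < b \<and> b < c \<and> c < d \<and>
     \<pi> d < \<pi> c \<and> \<pi> c < \<pi> a \<and> \<pi> a < \<pi> b)"

text \<open>
Involutions of an arbitrary set \<open>S\<close> are allowed, so that deleting cycles is restriction to a subset and
needs no relabelling of the remaining entries. The conditions on \<open>A\<close> record what the deleted part has to know about the rest;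
\<open>A\<close> will be an initial segment of \<open>S\<close>, and then every \<open>\<pi> i\<close> with \<open>i \<in> A\<close> lies above all of \<open>A\<close>.
\<close>
definition avoiders :: "nat set \<Rightarrow> nat set \<Rightarrow> (nat \<Rightarrow> nat) set" where
  "avoiders S A = {\<pi>. \<pi> permutes S \<and> (\<forall>i. \<pi> (\<pi> i) = i) \<and> \<not> has_3421 S \<pi> \<and>
     (\<forall>i\<in>A. \<forall>j\<in>A. i < j \<longrightarrow> \<pi> i < \<pi> j) \<and> (\<forall>i\<in>A. \<pi> i \<notin> A)}"

text \<open>
These are the involutions without the pattern \<open>231\<close>. That they are direct sums of decreasing
permutations follows from \<open>card_layered_first_value\<close>, by iteration.
\<close>
definition layered :: "nat set \<Rightarrow> (nat \<Rightarrow> nat) set" where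
  "layered S = {\<sigma>. \<sigma> permutes S \<and> (\<forall>i. \<sigma> (\<sigma> i) = i) \<and>
     \<not> (\<exists>a\<in>S. \<exists>b\<in>S. \<exists>c\<in>S. a < b \<and> b < c \<and> \<sigma> c < \<sigma> a \<and> \<sigma> a < \<sigma> b)}"

lemma has_3421I:
  "\<lbrakk>a \<in> S; b \<in> S; c \<in> S; d \<in> S; a < b; b < c; c < d; \<pi> d < \<pi> c; \<pi> c < \<pi> a; \<pi> a < \<pi> b\<rbrakk>
    \<Longrightarrow> has_3421 S \<pi>"
  unfolding has_3421_def by blast

lemma contains_pattern_3421: "contains_pattern n \<pi> 4 perm3421 \<longleftrightarrow> has_3421 {1..n} \<pi>"
proof -
  have S: "{1..4} = {1, 2, 3, 4::nat}" by auto
  show ?thesis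
  proof
    assume "contains_pattern n \<pi> 4 perm3421"
    then obtain f where f: "strict_mono_on {1..4} f" "f ` {1..4} \<subseteq> {1..n}"
      "\<forall>a\<in>{1..4}. \<forall>b\<in>{1..4}. \<pi> (f a) < \<pi> (f b) \<longleftrightarrow> perm3421 a < perm3421 b"
      unfolding contains_pattern_def by blast
    have lt: "f 1 < f 2" "f 2 < f 3" "f 3 < f 4"
      using f(1) by (auto simp: strict_mono_on_def)
    have v: "\<pi> (f 4) < \<pi> (f 3)" "\<pi> (f 3) < \<pi> (f 1)" "\<pi> (f 1) < \<pi> (f 2)"
      using f(3) unfolding S by (auto simp: perm3421_def)
    have "f i \<in> {1..n}" if "i \<in> {1, 2, 3, 4}" for i
      using f(2) that unfolding S by blast
    then show "has_3421 {1..n} \<pi>"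
      by (intro has_3421I[of "f 1" _ "f 2" "f 3" "f 4"] lt v) auto
  next
    assume "has_3421 {1..n} \<pi>"
    then obtain a b c d where h: "a \<in> {1..n}" "b \<in> {1..n}" "c \<in> {1..n}" "d \<in> {1..n}"
      "a < b" "b < c" "c < d" "\<pi> d < \<pi> c" "\<pi> c < \<pi> a" "\<pi> a < \<pi> b"
      unfolding has_3421_def by blast
    define f :: "nat \<Rightarrow> nat"
      where "f i = (if i = 1 then a else if i = 2 then b else if i = 3 then c else d)" for i
    have "strict_mono_on {1..4} f" "f ` {1..4} \<subseteq> {1..n}"
      "\<forall>a\<in>{1..4}. \<forall>b\<in>{1..4}. \<pi> (f a) < \<pi> (f b) \<longleftrightarrow> perm3421 a < perm3421 b"
      unfolding S using h by (auto simp: f_def strict_mono_on_def perm3421_def)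
    then show "contains_pattern n \<pi> 4 perm3421"
      unfolding contains_pattern_def by blast
  qed
qed

lemma num_avoiding_involutions_eq_card_avoiders:
  "num_avoiding_involutions n = card (avoiders {1..n} {})"
proof -
  have "\<pi> (\<pi> i) = i" if "\<pi> permutes {1..n}" "\<forall>i\<in>{1..n}. \<pi> (\<pi> i) = i" for \<pi> and i :: nat
    using that by (metis permutes_not_in)
  then show ?thesis
    unfolding num_avoiding_involutions_def avoiders_def involutions_def contains_pattern_3421
    by (intro arg_cong[where f = card]) auto
qed

lemma finite_avoiders: "finite S \<Longrightarrow> finite (avoiders S A)"
  unfolding avoiders_def by (rule finite_subset[OF _ finite_permutations[of S]]) auto

lemma finite_layered: "finite S \<Longrightarrow> finite (layered S)"
  unfolding layered_def by (rule finite_subset[OF _ finite_permutations[of S]]) auto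

section \<open>Invariance under relabelling\<close>

text \<open>
Conjugation by \<open>\<phi>\<close> is injective and preserves patterns. The converse inequality is the same fact for the
inverse of \<open>\<phi>\<close>.
\<close>
lemma card_avoiders_le_image:
  assumes \<phi>: "strict_mono_on S \<phi>" and A: "A \<subseteq> S" and fin: "finite S"
  shows "card (avoiders S A) \<le> card (avoiders (\<phi> ` S) (\<phi> ` A))"
proof -
  have inj: "inj_on \<phi> S" using \<phi> by (rule strict_mono_on_imp_inj_on)
  define \<psi> where "\<psi> = inv_into S \<phi>"
  have \<psi>: "\<psi> (\<phi> x) = x" if "x \<in> S" for x
    using inj that by (simp add: \<psi>_def)
  have less: "\<phi> x < \<phi> y \<longleftrightarrow> x < y" if "x \<in> S" "y \<in> S" for x y
    using \<phi> that by (rule strict_mono_on_less)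
  define F where "F \<pi> = (\<lambda>y. if y \<in> \<phi> ` S then \<phi> (\<pi> (\<psi> y)) else y)" for \<pi> :: "nat \<Rightarrow> nat"
  have F: "F \<pi> (\<phi> x) = \<phi> (\<pi> x)" if "x \<in> S" for \<pi> x
    using that by (simp add: F_def \<psi>)
  have into: "F \<pi> \<in> avoiders (\<phi> ` S) (\<phi> ` A)" if \<pi>: "\<pi> \<in> avoiders S A" for \<pi>
  proof -
    have p: "\<pi> permutes S" and inv: "\<And>i. \<pi> (\<pi> i) = i" and no: "\<not> has_3421 S \<pi>"
      and mono: "\<And>i j. i \<in> A \<Longrightarrow> j \<in> A \<Longrightarrow> i < j \<Longrightarrow> \<pi> i < \<pi> j" and out: "\<And>i. i \<in> A \<Longrightarrow> \<pi> i \<notin> A"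
      using \<pi> by (auto simp: avoiders_def)
    have cl: "\<pi> x \<in> S" if "x \<in> S" for x
      using p that by (simp add: permutes_in_image)
    have "F \<pi> permutes \<phi> ` S"
      unfolding F_def \<psi>_def
      by (rule permutes_bij_inv_into[OF p]) (use inj in \<open>simp add: bij_betw_def\<close>)
    moreover have "F \<pi> (F \<pi> y) = y" for y
    proof (cases "y \<in> \<phi> ` S")
      case True
      then show ?thesis using F cl inv by auto
    qed (simp add: F_def)
    moreover have "\<not> has_3421 (\<phi> ` S) (F \<pi>)"
    proof
      assume "has_3421 (\<phi> ` S) (F \<pi>)"
      then obtain a b c d where "a \<in> S" "b \<in> S" "c \<in> S" "d \<in> S"
        "\<phi> a < \<phi> b" "\<phi> b < \<phi> c" "\<phi> c < \<phi> d"
        "F \<pi> (\<phi> d) < F \<pi> (\<phi> c)" "F \<pi> (\<phi> c) < F \<pi> (\<phi> a)" "F \<pi> (\<phi> a) < F \<pi> (\<phi> b)"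
        unfolding has_3421_def by blast
      then have "has_3421 S \<pi>"
        by (intro has_3421I[of a S b c d]) (simp_all add: F less cl)
      with no show False ..
    qed
    moreover have "F \<pi> i < F \<pi> j" if ij: "i \<in> \<phi> ` A" "j \<in> \<phi> ` A" "i < j" for i j
    proof -
      obtain x y where "x \<in> A" "y \<in> A" "i = \<phi> x" "j = \<phi> y" using ij by blast
      then show ?thesis using ij(3) A mono by (simp add: F less cl subset_iff)
    qed
    moreover have "F \<pi> i \<notin> \<phi> ` A" if i: "i \<in> \<phi> ` A" for i
    proof
      obtain x where x: "x \<in> A" "i = \<phi> x" using i by blast
      assume "F \<pi> i \<in> \<phi> ` A"
      then obtain y where y: "y \<in> A" "F \<pi> i = \<phi> y" by blast
      then have "\<phi> (\<pi> x) = \<phi> y" using x A by (auto simp: F)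
      then have "\<pi> x = y" using inj x y A cl by (meson inj_onD subsetD)
      with out x y show False by blast
    qed
    ultimately show ?thesis unfolding avoiders_def by blast
  qed
  have "inj_on F (avoiders S A)"
  proof (rule inj_onI)
    fix \<pi> \<pi>' assume a: "\<pi> \<in> avoiders S A" "\<pi>' \<in> avoiders S A" and eq: "F \<pi> = F \<pi>'"
    have p: "\<pi> permutes S" "\<pi>' permutes S" using a by (auto simp: avoiders_def)
    show "\<pi> = \<pi>'"
    proof
      fix x show "\<pi> x = \<pi>' x"
      proof (cases "x \<in> S")
        case True
        then have "\<phi> (\<pi> x) = \<phi> (\<pi>' x)" using F eq by metis
        then show ?thesis using inj True p by (meson inj_onD permutes_in_image)
      qed (use p in \<open>simp add: permutes_not_in\<close>)
    qed
  qed
  then show ?thesis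
    by (rule card_inj_on_le) (use into fin in \<open>auto simp: finite_avoiders\<close>)
qed

lemma card_avoiders_image:
  assumes \<phi>: "strict_mono_on S \<phi>" and A: "A \<subseteq> S" and fin: "finite S"
  shows "card (avoiders (\<phi> ` S) (\<phi> ` A)) = card (avoiders S A)"
proof (rule antisym)
  have inj: "inj_on \<phi> S" using \<phi> by (rule strict_mono_on_imp_inj_on)
  have "strict_mono_on (\<phi> ` S) (inv_into S \<phi>)"
    using strict_mono_on_less[OF \<phi>] inj by (auto simp: strict_mono_on_def)
  from card_avoiders_le_image[OF this, of "\<phi> ` A"]
  show "card (avoiders (\<phi> ` S) (\<phi> ` A)) \<le> card (avoiders S A)"
    using A fin inj by (simp add: image_mono inv_into_image_cancel)
qed (rule card_avoiders_le_image[OF assms])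

section \<open>Decomposition along the cycle through 1\<close>

text \<open>
The index consists of the sizes \<open>r\<close> and \<open>m\<close> of the two groups of positions between \<open>1\<close> and its image
\<open>k = r + m + 2\<close>, because the number of involutions in a class is a product over the two parts that
are left when \<open>1\<close> and \<open>k\<close> are deleted.
\<close>
definition first_cycle_class :: "nat \<Rightarrow> nat \<Rightarrow> nat \<Rightarrow> (nat \<Rightarrow> nat) set" where
  "first_cycle_class N r m = {\<pi> \<in> avoiders {1..N + 2} {}. \<pi> 1 = r + m + 2 \<and>
     (\<forall>i\<in>{2..r + 1}. \<pi> i < r + m + 2) \<and> (\<forall>i\<in>{r + 2..r + m + 1}. r + m + 2 < \<pi> i)}"

text \<open>
The values \<open>k\<close> in position \<open>1\<close> and \<open>1\<close> in position \<open>k\<close>, together or alone, complete entries in between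
to \<open>3421\<close>: together they frame a large entry followed by a small one, \<open>k\<close> begins the pattern for two
decreasing large values, and \<open>1\<close> ends it after a \<open>231\<close>. The middle
part uses that \<open>\<pi>\<close> is an involution: a descent in two large values reappears as a descent in
the positions \<open>\<pi> j < \<pi> i\<close>, below and to the right of the ascent \<open>k, \<pi> i\<close>.
\<close>
lemma first_cycle_structure:
  assumes \<pi>: "\<pi> \<in> avoiders {1..n} {}" and k: "\<pi> 1 = k" "1 < k"
  shows "\<lbrakk>1 < i; i < j; j < k; k < \<pi> i\<rbrakk> \<Longrightarrow> k < \<pi> j"
    and "\<lbrakk>1 < i; i < j; j < k; k < \<pi> i; k < \<pi> j\<rbrakk> \<Longrightarrow> \<pi> i < \<pi> j"
    and "\<not> (1 < a \<and> a < b \<and> b < c \<and> c < k \<and> \<pi> c < \<pi> a \<and> \<pi> a < \<pi> b)"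
proof -
  have p: "\<pi> permutes {1..n}" and inv: "\<And>i. \<pi> (\<pi> i) = i" and no: "\<not> has_3421 {1..n} \<pi>"
    using \<pi> by (auto simp: avoiders_def)
  have cl: "\<pi> x \<in> {1..n}" if "x \<in> {1..n}" for x
    using permutes_in_image[OF p] that by blast
  have \<pi>k: "\<pi> k = 1" using inv k by metis
  have neq: "\<pi> x \<noteq> 1" if "x \<noteq> k" for x using that inv k by metis
  have neq': "\<pi> x \<noteq> k" if "x \<noteq> 1" for x using that inv \<pi>k by metis
  have kn: "k \<in> {1..n}"
  proof (cases "(1::nat) \<in> {1..n}")
    case True
    then show ?thesis using cl k by blast
  next
    case False
    then have "\<pi> 1 = 1" using p by (simp add: permutes_not_in)
    then show ?thesis using k by simp
  qed
  show "k < \<pi> j" if ij: "1 < i" "i < j" "j < k" "k < \<pi> i"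
  proof (rule ccontr)
    assume "\<not> k < \<pi> j"
    then have lt: "\<pi> j < k" using neq'[of j] ij by simp
    have "j \<in> {1..n}" using ij kn by simp
    then have "1 < \<pi> j" using cl[of j] neq[of j] ij by fastforce
    then have "has_3421 {1..n} \<pi>"
      by (intro has_3421I[of 1 _ i j k]) (use ij lt kn k \<pi>k in auto)
    with no show False ..
  qed
  show "\<pi> i < \<pi> j" if ij: "1 < i" "i < j" "j < k" "k < \<pi> i" "k < \<pi> j"
  proof (rule ccontr)
    assume "\<not> \<pi> i < \<pi> j"
    moreover have "\<pi> i \<noteq> \<pi> j" using inv ij by (metis less_irrefl)
    ultimately have gt: "\<pi> j < \<pi> i" by simp
    have "\<pi> i \<in> {1..n}" using ij kn by (intro cl) simp
    then have "has_3421 {1..n} \<pi>"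
      by (intro has_3421I[of 1 _ i "\<pi> j" "\<pi> i"]) (use ij gt kn k inv in auto)
    with no show False ..
  qed
  show "\<not> (1 < a \<and> a < b \<and> b < c \<and> c < k \<and> \<pi> c < \<pi> a \<and> \<pi> a < \<pi> b)"
  proof
    assume h: "1 < a \<and> a < b \<and> b < c \<and> c < k \<and> \<pi> c < \<pi> a \<and> \<pi> a < \<pi> b"
    then have "c \<in> {1..n}" using kn by simp
    then have "1 < \<pi> c" using cl[of c] neq[of c] h by fastforce
    then have "has_3421 {1..n} \<pi>"
      by (intro has_3421I[of a _ b c k]) (use h kn \<pi>k in auto)
    with no show False ..
  qed
qed

definition restrict_perm :: "nat set \<Rightarrow> (nat \<Rightarrow> nat) \<Rightarrow> nat \<Rightarrow> nat" where
  "restrict_perm A \<pi> = (\<lambda>x. if x \<in> A then \<pi> x else x)"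

lemma involution_permutes:
  assumes "\<And>i. \<pi> (\<pi> i) = i" "\<And>i. i \<notin> A \<Longrightarrow> \<pi> i = i"
  shows "\<pi> permutes A"
proof -
  have "\<exists>!x. \<pi> x = y" for y
    by (rule ex1I[of _ "\<pi> y"]) (use assms(1) in auto)
  then show ?thesis unfolding permutes_def using assms(2) by blast
qed

lemma restrict_perm_involution:
  assumes "\<And>i. \<pi> (\<pi> i) = i" "\<And>i. i \<in> A \<Longrightarrow> \<pi> i \<in> A"
  shows "restrict_perm A \<pi> permutes A" "restrict_perm A \<pi> (restrict_perm A \<pi> i) = i"
proof -
  show inv: "restrict_perm A \<pi> (restrict_perm A \<pi> i) = i" for i
    using assms by (simp add: restrict_perm_def)
  show "restrict_perm A \<pi> permutes A"
    by (rule involution_permutes[OF inv]) (simp add: restrict_perm_def)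
qed

text \<open>
An involution in the class is determined by its restrictions to the layered part \<open>A1\<close> and to the rest \<open>S\<close>.
Conversely, no occurrence of \<open>3421\<close> can be created by gluing. One inside \<open>A1 \<union> S\<close> would lie
in a single part, because \<open>A1\<close> lies to the left of and below \<open>S\<close>, and \<open>3421\<close> is not a direct sum. If it starts with the entry \<open>k\<close>
in position \<open>1\<close>, its last two entries come from a descent of \<open>\<rho>\<close> on \<open>A2\<close>; if it ends with
the entry \<open>1\<close> in position \<open>k\<close>, its first three entries form \<open>231\<close> within \<open>A1 \<union> A2\<close>, where \<open>A2\<close> carries increasing values
that exceed everything on \<open>A1\<close>, so that all of it would lie in the layered part.
\<close>
lemma bij_betw_first_cycle_class:
  fixes N r m :: nat
  defines "k \<equiv> r + m + 2"
  defines "A1 \<equiv> {2..r + 1}" and "A2 \<equiv> {r + 2..r + m + 1}"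
  defines "S \<equiv> {r + 2..N + 2} - {k}"
  assumes rm: "r + m \<le> N"
  shows "bij_betw (\<lambda>\<pi>. (restrict_perm A1 \<pi>, restrict_perm S \<pi>)) (first_cycle_class N r m)
    (layered A1 \<times> avoiders S A2)"
proof -
  define G where "G = (\<lambda>(\<sigma>, \<rho>) x. if x = 1 then k else if x = k then 1
    else if x \<in> A1 then \<sigma> x else \<rho> x :: nat)"
  have sets: "A1 \<inter> S = {}" "1 \<notin> A1" "k \<notin> A1" "1 \<notin> S" "k \<notin> S" "k \<noteq> 1" "A2 \<subseteq> S"
    "{1..N + 2} = insert 1 (insert k (A1 \<union> S))" "\<And>x. x \<in> A1 \<Longrightarrow> x \<noteq> 0" "0 \<notin> S" "\<And>x. x \<in> A1 \<Longrightarrow> x < k"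
    using rm by (auto simp: A1_def A2_def S_def k_def)
  have A2: "x \<in> A2 \<longleftrightarrow> x \<in> S \<and> x < k" for x
    using rm by (auto simp: A2_def S_def k_def)
  have A1S: "x < y" if "x \<in> A1" "y \<in> S" for x y
    using that by (auto simp: A1_def S_def)
  have fwd: "restrict_perm A1 \<pi> \<in> layered A1 \<and> restrict_perm S \<pi> \<in> avoiders S A2
      \<and> G (restrict_perm A1 \<pi>, restrict_perm S \<pi>) = \<pi>"
    if "\<pi> \<in> first_cycle_class N r m" for \<pi>
  proof -
    have \<pi>: "\<pi> \<in> avoiders {1..N + 2} {}" and k: "\<pi> 1 = k"
      and lo: "\<And>i. i \<in> A1 \<Longrightarrow> \<pi> i < k" and hi: "\<And>i. i \<in> A2 \<Longrightarrow> k < \<pi> i"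
      using that by (auto simp: first_cycle_class_def k_def A1_def A2_def)
    have p: "\<pi> permutes {1..N + 2}" and inv: "\<And>i. \<pi> (\<pi> i) = i"
      and no: "\<not> has_3421 {1..N + 2} \<pi>"
      using \<pi> by (auto simp: avoiders_def)
    have k1: "1 < k" by (simp add: k_def)
    have \<pi>k: "\<pi> k = 1" using inv k by metis
    have clA: "\<pi> x \<in> A1" if "x \<in> A1" for x
    proof -
      have "x \<in> {1..N + 2}" using that sets(8) by blast
      then have "\<pi> x \<in> {1..N + 2}" using permutes_in_image[OF p] by blast
      moreover have "\<pi> x \<notin> S"
      proof
        assume "\<pi> x \<in> S"
        then have "\<pi> x \<in> A2" using lo[OF that] A2 by blast
        from hi[OF this] show False using inv sets(11)[OF that] by simp
      qed
      moreover have "\<pi> x \<noteq> 1" "\<pi> x \<noteq> k"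
        using inv k \<pi>k that sets by metis+
      ultimately show ?thesis using sets(8) by blast
    qed
    have clS: "\<pi> x \<in> S" if "x \<in> S" for x
    proof -
      have "x \<in> {1..N + 2}" using that sets(8) by blast
      then have "\<pi> x \<in> {1..N + 2}" using permutes_in_image[OF p] by blast
      moreover have "\<pi> x \<notin> A1" using clA[of "\<pi> x"] inv that sets(1) by auto
      moreover have "\<pi> x \<noteq> 1" "\<pi> x \<noteq> k"
        using inv k \<pi>k that sets by metis+
      ultimately show ?thesis using sets(8) by blast
    qed
    have "restrict_perm A1 \<pi> \<in> layered A1"
    proof -
      have "\<not> (a < b \<and> b < c \<and> restrict_perm A1 \<pi> c < restrict_perm A1 \<pi> a
          \<and> restrict_perm A1 \<pi> a < restrict_perm A1 \<pi> b)" if "a \<in> A1" "b \<in> A1" "c \<in> A1" for a b c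
        using first_cycle_structure(3)[OF \<pi> k k1, of a b c] that
        by (simp add: restrict_perm_def) (simp add: A1_def k_def)
      then show ?thesis
        using restrict_perm_involution[of \<pi> A1, OF inv clA] unfolding layered_def by blast
    qed
    moreover have "restrict_perm S \<pi> \<in> avoiders S A2"
    proof -
      have "\<not> has_3421 S (restrict_perm S \<pi>)"
      proof
        assume "has_3421 S (restrict_perm S \<pi>)"
        then have "has_3421 S \<pi>"
          by (simp add: has_3421_def restrict_perm_def cong: bex_cong)
        then have "has_3421 {1..N + 2} \<pi>"
          unfolding has_3421_def sets(8) by blast
        with no show False ..
      qed
      moreover have on: "restrict_perm S \<pi> i = \<pi> i" if "i \<in> A2" for i
        using that sets(7) by (auto simp: restrict_perm_def)
      have "restrict_perm S \<pi> i < restrict_perm S \<pi> j" if "i \<in> A2" "j \<in> A2" "i < j" for i j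
        unfolding on[OF that(1)] on[OF that(2)]
        by (rule first_cycle_structure(2)[OF \<pi> k k1]) (use that hi in \<open>auto simp: A2_def k_def\<close>)
      moreover have "restrict_perm S \<pi> i \<notin> A2" if "i \<in> A2" for i
        unfolding on[OF that] using hi[OF that] A2 by (metis less_asym)
      ultimately show ?thesis
        using restrict_perm_involution[of \<pi> S, OF inv clS] unfolding avoiders_def by blast
    qed
    moreover have "G (restrict_perm A1 \<pi>, restrict_perm S \<pi>) = \<pi>"
    proof
      fix x
      have "\<pi> x = x" if "x \<noteq> 1" "x \<noteq> k" "x \<notin> A1" "x \<notin> S"
        using that sets(8) p by (metis Un_iff insert_iff permutes_not_in)
      then show "G (restrict_perm A1 \<pi>, restrict_perm S \<pi>) x = \<pi> x"
        using k \<pi>k by (auto simp: G_def restrict_perm_def)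
    qed
    ultimately show ?thesis by blast
  qed
  have bwd: "G (\<sigma>, \<rho>) \<in> first_cycle_class N r m \<and>
      restrict_perm A1 (G (\<sigma>, \<rho>)) = \<sigma> \<and> restrict_perm S (G (\<sigma>, \<rho>)) = \<rho>"
    if "\<sigma> \<in> layered A1" "\<rho> \<in> avoiders S A2" for \<sigma> \<rho>
  proof -
    define \<pi> where "\<pi> = G (\<sigma>, \<rho>)"
    have \<sigma>: "\<sigma> permutes A1" "\<And>i. \<sigma> (\<sigma> i) = i"
      and \<sigma>no: "\<And>a b c. \<lbrakk>a \<in> A1; b \<in> A1; c \<in> A1; a < b; b < c; \<sigma> c < \<sigma> a; \<sigma> a < \<sigma> b\<rbrakk> \<Longrightarrow> False"
      using that(1) unfolding layered_def by blast+
    have \<rho>: "\<rho> permutes S" "\<And>i. \<rho> (\<rho> i) = i" "\<not> has_3421 S \<rho>"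
      "\<And>i j. i \<in> A2 \<Longrightarrow> j \<in> A2 \<Longrightarrow> i < j \<Longrightarrow> \<rho> i < \<rho> j" "\<And>i. i \<in> A2 \<Longrightarrow> \<rho> i \<notin> A2"
      using that(2) by (auto simp: avoiders_def)
    have \<sigma>cl: "\<sigma> x \<in> A1 \<longleftrightarrow> x \<in> A1" and \<rho>cl: "\<rho> x \<in> S \<longleftrightarrow> x \<in> S" for x
      using \<sigma>(1) \<rho>(1) by (simp_all add: permutes_in_image)
    have on1: "\<pi> 1 = k" and onk: "\<pi> k = 1" and onA: "\<And>x. x \<in> A1 \<Longrightarrow> \<pi> x = \<sigma> x"
      and onS: "\<And>x. x \<in> S \<Longrightarrow> \<pi> x = \<rho> x"
      using sets by (auto simp: \<pi>_def G_def)
    have off: "\<pi> x = x" if "x \<notin> {1..N + 2}" for x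
      using that sets(8) \<rho>(1) by (auto simp: \<pi>_def G_def permutes_not_in)
    have inv: "\<pi> (\<pi> x) = x" for x
    proof (cases "x \<in> {1..N + 2}")
      case True
      then consider "x = 1" | "x = k" | "x \<in> A1" | "x \<in> S" using sets(8) by blast
      then show ?thesis
        using on1 onk onA onS \<sigma>cl \<rho>cl \<sigma>(2) \<rho>(2) by cases auto
    qed (simp add: off)
    have hi: "k < \<pi> i" if "i \<in> A2" for i
      using that \<rho>(5)[OF that] \<rho>cl[of i] onS[of i] A2 sets(5) by (metis linorder_neqE_nat)
    have lo: "\<pi> i < k" if "i \<in> A1" for i
      using that onA \<sigma>cl sets(11) by simp
    have no: False if abcd: "a \<in> {1..N + 2}" "b \<in> {1..N + 2}" "c \<in> {1..N + 2}" "d \<in> {1..N + 2}"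
      "a < b" "b < c" "c < d" "\<pi> d < \<pi> c" "\<pi> c < \<pi> a" "\<pi> a < \<pi> b" for a b c d
    proof -
      have pos: "1 \<le> \<pi> x" if "x \<in> {1..N + 2}" for x
      proof (rule ccontr)
        assume "\<not> 1 \<le> \<pi> x"
        then have "\<pi> (\<pi> x) = \<pi> x" by (intro off) auto
        then show False using that inv \<open>\<not> 1 \<le> \<pi> x\<close> by simp
      qed
      have nk: "a \<noteq> k" "b \<noteq> k" "c \<noteq> k"
        using abcd pos[of d] onk by auto
      have part: "x = 1 \<or> x = k \<or> x \<in> A1 \<or> x \<in> S" if "x \<in> {1..N + 2}" for x
        using that sets(8) by blast
      have n1: "b \<noteq> 1" "c \<noteq> 1" "d \<noteq> 1" using abcd by auto
      show False
      proof (cases "a = 1")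
        \<comment> \<open>The smallest two entries \<open>\<pi> c\<close> and \<open>\<pi> d\<close> will be shown to be positions in \<open>A2\<close> at which \<open>\<rho>\<close> descends.\<close>
        case True
        then have kb: "k < \<pi> b" using abcd on1 by simp
        then have "b \<in> S" using part[OF abcd(2)] nk n1 lo[of b] by auto
        have cS: "c \<in> S"
          using part[OF abcd(3)] nk n1 A1S[OF _ \<open>b \<in> S\<close>, of c] abcd(6) by auto
        have ck: "\<pi> c < k" "\<pi> d < k" using abcd True on1 by auto
        have "c \<notin> A2" using hi[of c] ck by auto
        then have "k < c" using cS A2 sets(5) by (metis linorder_neqE_nat)
        then have "k < d" using abcd(7) by simp
        then have dS: "d \<in> S"
          using part[OF abcd(4)] n1(3) sets(11)[of d] by auto
        have "\<pi> c \<in> A2" "\<pi> d \<in> A2"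
          using cS dS onS \<rho>cl ck A2 by auto
        from \<rho>(4)[OF this(2,1) abcd(8)] show False
          using onS[OF cS] onS[OF dS] \<rho>(2) abcd(7) by simp
      next
        case a1: False
        show False
        proof (cases "d = k")
          case True
          have "x \<in> A1 \<union> A2" if "x \<in> {1..N + 2}" "x \<noteq> 1" "x < k" for x
            using part[OF that(1)] that(2,3) A2 by blast
          then have "a \<in> A1 \<union> A2" "b \<in> A1 \<union> A2" "c \<in> A1 \<union> A2"
            using abcd(1-7) True a1 n1 by (metis less_trans)+
          moreover have "c \<notin> A2"
          proof
            assume c: "c \<in> A2"
            then have "a \<in> A2" using hi[of c] lo[of a] abcd(9) \<open>a \<in> A1 \<union> A2\<close> by force
            then have "\<rho> a < \<rho> c" using \<rho>(4)[OF _ c] abcd(5,6) by simp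
            then show False using abcd(9) onS A2 c \<open>a \<in> A2\<close> by simp
          qed
          ultimately have "a \<in> A1" "b \<in> A1" "c \<in> A1"
            using A1S[of c a] A1S[of c b] abcd(5,6) A2 by auto
          then show False using \<sigma>no[of a b c] abcd(5-10) onA by simp
        next
          case dk: False
          have mem: "a \<in> A1 \<union> S" "b \<in> A1 \<union> S" "c \<in> A1 \<union> S" "d \<in> A1 \<union> S"
            using part[OF abcd(1)] part[OF abcd(2)] part[OF abcd(3)] part[OF abcd(4)] nk n1 a1 dk
            by blast+
          show False
          proof (cases "a \<in> S")
            case True
            have "b \<in> S" "c \<in> S" "d \<in> S"
              using A1S[OF _ True, of b] A1S[OF _ True, of c] A1S[OF _ True, of d] mem abcd(5-7)
              by auto
            then have "has_3421 S \<rho>"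
              using True abcd(5-10) by (intro has_3421I[of a S b c d]) (simp_all add: onS)
            with \<rho>(3) show False ..
          next
            case False
            then have a: "a \<in> A1" using mem by blast
            have "\<pi> c \<notin> S" using A1S[of "\<pi> a" "\<pi> c"] a onA \<sigma>cl abcd by auto
            then have c: "c \<in> A1" using mem(3) onS[of c] \<rho>cl[of c] by auto
            then have "b \<in> A1" using A1S[of c b] mem(2) abcd(6) by auto
            then show False using a c \<sigma>no[of a b c] abcd(5-10) onA by simp
          qed
        qed
      qed
    qed
    have "\<pi> permutes {1..N + 2}" by (rule involution_permutes[OF inv off])
    moreover have "\<not> has_3421 {1..N + 2} \<pi>"
      unfolding has_3421_def by (intro notI, elim bexE conjE) (rule no)
    ultimately have "\<pi> \<in> avoiders {1..N + 2} {}"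
      using inv by (simp add: avoiders_def)
    then have "\<pi> \<in> first_cycle_class N r m"
      using on1 lo hi by (auto simp: first_cycle_class_def k_def A1_def A2_def)
    moreover have "restrict_perm A1 \<pi> = \<sigma>" "restrict_perm S \<pi> = \<rho>"
      using \<sigma>(1) \<rho>(1) onA onS by (auto simp: restrict_perm_def permutes_not_in)
    ultimately show ?thesis unfolding \<pi>_def by blast
  qed
  show ?thesis
    by (rule bij_betw_byWitness[where f' = G]) (use fwd bwd in auto)
qed

text \<open>
The part outside the layered block has the ground set \<open>{r + 2..N + 2}\<close> without \<open>k\<close>; the map \<open>\<phi>\<close>
is the increasing enumeration of this set, which jumps over \<open>k\<close> after \<open>m\<close> steps.
\<close>
lemma card_first_cycle_class:
  assumes rm: "r + m \<le> N"
  shows "card (first_cycle_class N r m) =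
    card (layered {2..r + 1}) * card (avoiders {1..N - r} {1..m})"
proof -
  define \<phi> where "\<phi> i = (if i \<le> m then i + r + 1 else i + r + 2)" for i
  have "card (first_cycle_class N r m) = card (layered {2..r + 1}) *
      card (avoiders ({r + 2..N + 2} - {r + m + 2}) {r + 2..r + m + 1})"
    using bij_betw_same_card[OF bij_betw_first_cycle_class[OF rm]] by (simp add: card_cartesian_product)
  also have "{r + 2..N + 2} - {r + m + 2} = \<phi> ` {1..N - r}"
  proof (intro equalityI subsetI)
    fix x assume x: "x \<in> {r + 2..N + 2} - {r + m + 2}"
    show "x \<in> \<phi> ` {1..N - r}"
    proof (cases "x < r + m + 2")
      case True
      then show ?thesis using x rm by (intro image_eqI[of _ _ "x - r - 1"]) (auto simp: \<phi>_def)
    next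
      case False
      then show ?thesis using x rm by (intro image_eqI[of _ _ "x - r - 2"]) (auto simp: \<phi>_def)
    qed
  qed (use rm in \<open>auto simp: \<phi>_def split: if_splits\<close>)
  also have "{r + 2..r + m + 1} = \<phi> ` {1..m}"
  proof (intro equalityI subsetI)
    fix x assume "x \<in> {r + 2..r + m + 1}"
    then show "x \<in> \<phi> ` {1..m}" by (intro image_eqI[of _ _ "x - r - 1"]) (auto simp: \<phi>_def)
  qed (auto simp: \<phi>_def)
  also have "card (avoiders (\<phi> ` {1..N - r}) (\<phi> ` {1..m})) = card (avoiders {1..N - r} {1..m})"
    by (rule card_avoiders_image) (use rm in \<open>auto simp: \<phi>_def strict_mono_on_def\<close>)
  finally show ?thesis .
qed

section \<open>Counting layered involutions\<close>

text \<open>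
The \<open>i - p\<close> values at smaller arguments are distinct and lie above \<open>f i\<close>, and the \<open>q - i\<close> values at larger
arguments lie below it. Both bounds on \<open>f i\<close> agree.
\<close>
lemma decreasing_self_map_of_interval:
  fixes f :: "nat \<Rightarrow> nat"
  assumes into: "\<And>i. i \<in> {p..q} \<Longrightarrow> f i \<in> {p..q}"
    and dec: "\<And>i j. \<lbrakk>i \<in> {p..q}; j \<in> {p..q}; i < j\<rbrakk> \<Longrightarrow> f j < f i"
    and i: "i \<in> {p..q}"
  shows "f i = p + q - i"
proof -
  have inj: "inj_on f {p..q}"
    using dec by (intro linorder_inj_onI') (metis less_irrefl)
  have "card {p..<i} \<le> card {f i<..q}"
  proof (rule card_inj_on_le)
    show "inj_on f {p..<i}" using inj by (rule inj_on_subset) (use i in auto)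
    show "f ` {p..<i} \<subseteq> {f i<..q}"
    proof
      fix y assume "y \<in> f ` {p..<i}"
      then obtain x where x: "x \<in> {p..<i}" "y = f x" by blast
      then have "x \<in> {p..q}" using i by simp
      then show "y \<in> {f i<..q}" using into[of x] dec[OF _ i, of x] x by simp
    qed
  qed simp
  moreover have "card {i<..q} \<le> card {p..<f i}"
  proof (rule card_inj_on_le)
    show "inj_on f {i<..q}" using inj by (rule inj_on_subset) (use i in auto)
    show "f ` {i<..q} \<subseteq> {p..<f i}"
    proof
      fix y assume "y \<in> f ` {i<..q}"
      then obtain x where x: "x \<in> {i<..q}" "y = f x" by blast
      then have "x \<in> {p..q}" using i by simp
      then show "y \<in> {p..<f i}" using into[of x] dec[OF i, of x] x by simp
    qed
  qed simp
  ultimately show ?thesis using i into[OF i] by simp linarith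
qed

text \<open>
If \<open>\<sigma> p = q\<close>, then \<open>\<sigma> q = p\<close>, and this smallest value is the last entry of a \<open>231\<close> with any ascent to its left. So \<open>\<sigma>\<close> maps
\<open>{p..q}\<close> to itself and decreases there, which determines it on this first layer; the remaining
layers are arbitrary.
\<close>
lemma card_layered_first_value:
  assumes pq: "p \<le> q" "q \<le> e"
  shows "card {\<sigma> \<in> layered {p..e}. \<sigma> p = q} = card (layered {q + 1..e})"
proof -
  define G where "G \<tau> x = (if x \<in> {p..q} then p + q - x else \<tau> x)" for \<tau> :: "nat \<Rightarrow> nat" and x
  let ?U = "{q + 1..e}"
  have fwd: "restrict_perm ?U \<sigma> \<in> layered ?U \<and> G (restrict_perm ?U \<sigma>) = \<sigma>"
    if "\<sigma> \<in> layered {p..e}" and \<sigma>p: "\<sigma> p = q" for \<sigma>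
  proof -
    have perm: "\<sigma> permutes {p..e}" and inv: "\<And>i. \<sigma> (\<sigma> i) = i"
      and no: "\<And>a b c. \<lbrakk>a \<in> {p..e}; b \<in> {p..e}; c \<in> {p..e}; a < b; b < c; \<sigma> c < \<sigma> a; \<sigma> a < \<sigma> b\<rbrakk>
        \<Longrightarrow> False"
      using that(1) unfolding layered_def by blast+
    have cl: "\<sigma> x \<in> {p..e}" if "x \<in> {p..e}" for x
      using permutes_in_image[OF perm] that by blast
    have \<sigma>q: "\<sigma> q = p" using inv \<sigma>p by metis
    have neq: "\<sigma> x \<noteq> \<sigma> y" if "x \<noteq> y" for x y using inv that by metis
    have block: "\<sigma> i \<in> {p..q}" if i: "i \<in> {p..q}" for i
    proof (rule ccontr)
      assume "\<sigma> i \<notin> {p..q}"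
      moreover have "\<sigma> i \<in> {p..e}" using i pq by (intro cl) simp
      ultimately have gt: "q < \<sigma> i" by simp
      then have "i \<noteq> p" "i \<noteq> q" using \<sigma>p \<sigma>q pq by auto
      then show False using no[of p i q] i gt \<sigma>p \<sigma>q pq by simp
    qed
    have dec: "\<sigma> j < \<sigma> i" if ij: "i \<in> {p..q}" "j \<in> {p..q}" "i < j" for i j
    proof (rule ccontr)
      assume "\<not> \<sigma> j < \<sigma> i"
      then have lt: "\<sigma> i < \<sigma> j" using neq[of i j] ij(3) by simp
      have "j \<noteq> q" using lt \<sigma>q block[OF ij(1)] by auto
      then have "p < \<sigma> i" using block[OF ij(1)] neq[of i q] \<sigma>q ij by force
      then show False using no[of i j q] ij lt \<sigma>q pq \<open>j \<noteq> q\<close> by simp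
    qed
    have rev: "\<sigma> i = p + q - i" if "i \<in> {p..q}" for i
      using block dec that by (rule decreasing_self_map_of_interval)
    have clU: "\<sigma> x \<in> ?U" if x: "x \<in> ?U" for x
    proof -
      have "\<sigma> x \<in> {p..e}" using x pq by (intro cl) simp
      moreover have "\<sigma> x \<notin> {p..q}" using block[of "\<sigma> x"] inv[of x] x by auto
      ultimately show ?thesis by auto
    qed
    have "\<not> (a < b \<and> b < c \<and> restrict_perm ?U \<sigma> c < restrict_perm ?U \<sigma> a
          \<and> restrict_perm ?U \<sigma> a < restrict_perm ?U \<sigma> b)" if "a \<in> ?U" "b \<in> ?U" "c \<in> ?U" for a b c
      using no[of a b c] that pq unfolding restrict_perm_def by auto
    then have "restrict_perm ?U \<sigma> \<in> layered ?U"
      using restrict_perm_involution[of \<sigma> ?U, OF inv clU] unfolding layered_def by blast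
    moreover have "G (restrict_perm ?U \<sigma>) x = \<sigma> x" for x
    proof (cases "x \<in> {p..e}")
      case True
      then show ?thesis using rev by (auto simp: G_def restrict_perm_def)
    next
      case False
      then have "\<sigma> x = x" by (rule permutes_not_in[OF perm])
      then show ?thesis using False pq by (auto simp: G_def restrict_perm_def)
    qed
    ultimately show ?thesis by blast
  qed
  have bwd: "G \<tau> \<in> layered {p..e} \<and> G \<tau> p = q \<and> restrict_perm ?U (G \<tau>) = \<tau>"
    if "\<tau> \<in> layered ?U" for \<tau>
  proof -
    have perm: "\<tau> permutes ?U" and inv: "\<And>i. \<tau> (\<tau> i) = i"
      and no: "\<And>a b c. \<lbrakk>a \<in> ?U; b \<in> ?U; c \<in> ?U; a < b; b < c; \<tau> c < \<tau> a; \<tau> a < \<tau> b\<rbrakk> \<Longrightarrow> False"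
      using that unfolding layered_def by blast+
    have cl: "\<tau> x \<in> ?U \<longleftrightarrow> x \<in> ?U" for x
      by (rule permutes_in_image[OF perm])
    have fixed: "\<tau> x = x" if "x \<notin> ?U" for x
      using that by (rule permutes_not_in[OF perm])
    have on: "G \<tau> x = p + q - x" if "x \<in> {p..q}" for x
      using that by (simp add: G_def)
    have onU: "G \<tau> x = \<tau> x" if "x \<in> ?U" for x
      using that by (simp add: G_def)
    have off: "G \<tau> x = x" if "x \<notin> {p..e}" for x
      using that pq fixed[of x] by (auto simp: G_def)
    have invG: "G \<tau> (G \<tau> x) = x" for x
    proof -
      consider "x \<in> {p..q}" | "x \<in> ?U" | "x \<notin> {p..e}" by fastforce
      then show ?thesis
      proof cases
        case 1
        then have "p + q - x \<in> {p..q}" by auto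
        then show ?thesis using 1 by (simp add: on)
      next
        case 2
        then show ?thesis using cl[of x] by (simp only: onU inv)
      qed (simp add: off)
    qed
    have False if abc: "a \<in> {p..e}" "b \<in> {p..e}" "c \<in> {p..e}" "a < b" "b < c"
      "G \<tau> c < G \<tau> a" "G \<tau> a < G \<tau> b" for a b c
    proof (cases "a \<in> {p..q}")
      case True
      show False
      proof (cases "b \<in> {p..q}")
        case bq: True
        then show False using abc(4,7) on[OF True] on[OF bq] by simp
      next
        case False
        then have "c \<in> ?U" using abc by simp
        then have "q < G \<tau> c" using onU[of c] cl[of c] by simp
        then show False using abc(6) on[OF True] True by simp linarith
      qed
    next
      case False
      then have U: "a \<in> ?U" "b \<in> ?U" "c \<in> ?U" using abc(1-5) by auto
      from no[OF this abc(4,5)] show False using abc(6,7) unfolding onU[OF U(1)] onU[OF U(2)] onU[OF U(3)] .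
    qed
    then have "G \<tau> \<in> layered {p..e}"
      using involution_permutes[OF invG off] invG unfolding layered_def by blast
    moreover have "restrict_perm ?U (G \<tau>) x = \<tau> x" for x
      using fixed[of x] onU[of x] unfolding restrict_perm_def by auto
    ultimately show ?thesis using on[of p] pq by auto
  qed
  have "bij_betw (restrict_perm ?U) {\<sigma> \<in> layered {p..e}. \<sigma> p = q} (layered ?U)"
    by (rule bij_betw_byWitness[where f' = G]) (use fwd bwd in blast)+
  then show ?thesis by (rule bij_betw_same_card)
qed

definition num_layered :: "nat \<Rightarrow> nat" where
  "num_layered r = (if r = 0 then 1 else 2 ^ (r - 1))"

text \<open>
The recursion over the size of the first layer is solved by \<open>num_layered\<close>: a layered permutation of length
\<open>r > 0\<close> is a composition of \<open>r\<close>.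
\<close>
lemma sum_num_layered: "(\<Sum>d\<le>n. num_layered d) = 2 ^ n"
  by (induction n) (auto simp: num_layered_def)

lemma card_layered: "card (layered {a + 1..a + r}) = num_layered r"
proof (induction r arbitrary: a rule: less_induct)
  case (less r)
  show ?case
  proof (cases r)
    case 0
    have "layered {} = {id}"
      unfolding layered_def by (auto simp: permutes_empty)
    then show ?thesis using 0 by (simp add: num_layered_def)
  next
    case (Suc s)
    let ?T = "{a + 1..a + r}"
    let ?C = "\<lambda>d. {\<sigma> \<in> layered ?T. \<sigma> (a + 1) = a + 1 + d}"
    have "layered ?T = (\<Union>d\<le>s. ?C d)"
    proof (intro equalityI subsetI)
      fix \<sigma> assume \<sigma>: "\<sigma> \<in> layered ?T"
      then have "\<sigma> permutes ?T" by (simp add: layered_def)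
      then have "\<sigma> (a + 1) \<in> ?T" using Suc by (subst permutes_in_image) auto
      then show "\<sigma> \<in> (\<Union>d\<le>s. ?C d)"
        using \<sigma> Suc by (intro UN_I[of "\<sigma> (a + 1) - (a + 1)"]) auto
    qed auto
    also have "card \<dots> = (\<Sum>d\<le>s. card (?C d))"
      by (rule card_UN_disjoint) (auto simp: finite_layered)
    also have "\<dots> = (\<Sum>d\<le>s. num_layered (s - d))"
    proof (rule sum.cong[OF refl])
      fix d assume d: "d \<in> {..s}"
      have "card (?C d) = card (layered {a + 1 + d + 1..a + r})"
        by (rule card_layered_first_value) (use d Suc in auto)
      also have "{a + 1 + d + 1..a + r} = {a + 1 + d + 1..a + 1 + d + (s - d)}" using d Suc by simp
      also have "card (layered \<dots>) = num_layered (s - d)"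
        by (rule less) (use Suc in simp)
      finally show "card (?C d) = num_layered (s - d)" .
    qed
    also have "\<dots> = (\<Sum>d\<le>s. num_layered d)"
      by (rule sum.nat_diff_reindex[of num_layered "Suc s", unfolded lessThan_Suc_atMost, simplified])
    also have "\<dots> = num_layered r"
      unfolding sum_num_layered by (simp add: num_layered_def Suc)
    finally show ?thesis .
  qed
qed

section \<open>Recursion for the number of avoiding involutions\<close>

definition num_increasing :: "nat \<Rightarrow> nat \<Rightarrow> nat" where
  "num_increasing n m = card (avoiders {1..n} {1..m})"

text \<open>
For \<open>m > n\<close> the set \<open>{1..m}\<close> contains \<open>m\<close>, which is a fixed point because it lies outside the ground set. The fact makes
the order of the generating functions below grow with \<open>m\<close>.
\<close>
lemma num_increasing_eq_0: "n < m \<Longrightarrow> num_increasing n m = 0"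
proof -
  assume "n < m"
  have False if "\<pi> \<in> avoiders {1..n} {1..m}" for \<pi>
  proof -
    have "\<pi> permutes {1..n}" "\<pi> m \<notin> {1..m}"
      using that \<open>n < m\<close> by (auto simp: avoiders_def)
    then show False using \<open>n < m\<close> permutes_not_in[of \<pi> "{1..n}" m] by simp
  qed
  then have "avoiders {1..n} {1..m} = {}" by blast
  then show ?thesis by (simp add: num_increasing_def)
qed

lemma num_increasing_0_0: "num_increasing 0 0 = 1"
proof -
  have "avoiders {} {} = {id}"
    unfolding avoiders_def by (auto simp: permutes_empty has_3421_def)
  then show ?thesis by (simp add: num_increasing_def)
qed

lemma num_increasing_1_1: "num_increasing 1 1 = 0"
proof -
  have False if "\<pi> \<in> avoiders {1} {1}" for \<pi>
  proof -
    have "\<pi> permutes {1}" "\<pi> 1 \<notin> {1}" using that by (auto simp: avoiders_def)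
    then show False using permutes_in_image[of \<pi> "{1}" 1] by simp
  qed
  then have "avoiders {1} {1} = {}" by blast
  then show ?thesis by (simp add: num_increasing_def)
qed

text \<open>
A fixed point \<open>1\<close> is the first and smallest entry, and \<open>3421\<close> does not begin with its smallest entry.
\<close>
lemma avoiders_fixing_1: "{\<pi> \<in> avoiders {1..Suc n} {}. \<pi> 1 = 1} = avoiders {2..Suc n} {}"
proof -
  have "\<pi> \<in> avoiders {2..Suc n} {}" if "\<pi> \<in> avoiders {1..Suc n} {}" and \<pi>1: "\<pi> 1 = 1" for \<pi>
  proof -
    have p: "\<pi> permutes {1..Suc n}" and inv: "\<And>i. \<pi> (\<pi> i) = i"
      and no: "\<not> has_3421 {1..Suc n} \<pi>"
      using that(1) by (auto simp: avoiders_def)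
    have "\<pi> i = i" if "i \<notin> {2..Suc n}" for i
      using that \<pi>1 permutes_not_in[OF p, of i] by (cases "i = 1") auto
    then have "\<pi> permutes {2..Suc n}" using inv by (intro involution_permutes)
    moreover have "has_3421 {1..Suc n} \<pi>" if "has_3421 {2..Suc n} \<pi>"
      using that unfolding has_3421_def by fastforce
    ultimately show ?thesis using inv no by (auto simp: avoiders_def)
  qed
  moreover have "\<pi> \<in> avoiders {1..Suc n} {} \<and> \<pi> 1 = 1" if "\<pi> \<in> avoiders {2..Suc n} {}" for \<pi>
  proof -
    have p: "\<pi> permutes {2..Suc n}" and inv: "\<And>i. \<pi> (\<pi> i) = i"
      and no: "\<not> has_3421 {2..Suc n} \<pi>"
      using that by (auto simp: avoiders_def)
    have \<pi>1: "\<pi> 1 = 1" by (rule permutes_not_in[OF p]) simp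
    have "\<pi> permutes {1..Suc n}" by (rule permutes_subset[OF p]) auto
    moreover have "\<not> has_3421 {1..Suc n} \<pi>"
    proof
      assume "has_3421 {1..Suc n} \<pi>"
      then obtain a b c d where h: "a \<in> {1..Suc n}" "b \<in> {1..Suc n}" "c \<in> {1..Suc n}" "d \<in> {1..Suc n}"
        "a < b" "b < c" "c < d" "\<pi> d < \<pi> c" "\<pi> c < \<pi> a" "\<pi> a < \<pi> b"
        unfolding has_3421_def by blast
      have "\<pi> c \<noteq> 0"
      proof
        assume "\<pi> c = 0"
        then have "c = \<pi> 0" using inv by metis
        then show False using permutes_not_in[OF p, of 0] h by simp
      qed
      then have "a \<noteq> 1" using h \<pi>1 by auto
      then have "has_3421 {2..Suc n} \<pi>"
        using h by (intro has_3421I[of a _ b c d]) auto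
      with no show False ..
    qed
    ultimately show ?thesis using inv \<pi>1 by (auto simp: avoiders_def)
  qed
  ultimately show ?thesis by blast
qed

lemma num_increasing_Suc_0:
  "num_increasing (Suc n) 0 = num_increasing n 0 + num_increasing (Suc n) 1"
proof -
  have "avoiders {1..Suc n} {} = {\<pi> \<in> avoiders {1..Suc n} {}. \<pi> 1 = 1} \<union> avoiders {1..Suc n} {1}"
    unfolding avoiders_def by auto
  then have "avoiders {1..Suc n} {} = avoiders {2..Suc n} {} \<union> avoiders {1..Suc n} {1}"
    unfolding avoiders_fixing_1 .
  moreover have "avoiders {2..Suc n} {} \<inter> avoiders {1..Suc n} {1} = {}"
    unfolding avoiders_fixing_1[symmetric] by (auto simp: avoiders_def)
  ultimately have "card (avoiders {1..Suc n} {}) =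
      card (avoiders {2..Suc n} {}) + card (avoiders {1..Suc n} {1})"
    by (simp add: card_Un_disjoint finite_avoiders)
  moreover have "card (avoiders (Suc ` {1..n}) (Suc ` {})) = card (avoiders {1..n} {})"
    by (rule card_avoiders_image) (auto simp: strict_mono_on_def)
  ultimately show ?thesis
    by (simp add: num_increasing_def image_Suc_atLeastAtMost numeral_2_eq_2)
qed

text \<open>
The class of \<open>\<pi>\<close> is found from the first position \<open>l \<ge> 2\<close> whose value exceeds \<open>k = \<pi> 1\<close>, or \<open>l = k\<close> if there is none
before \<open>k\<close>: by \<open>first_cycle_structure\<close>, all positions from \<open>l\<close> to \<open>k - 1\<close> then have values above \<open>k\<close>.
\<close>
lemma avoiders_first_not_fixed:
  "avoiders {1..n + 2} {1} = (\<Union>(r, m)\<in>Sigma {..n} (\<lambda>r. {..n - r}). first_cycle_class n r m)"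
proof (intro equalityI subsetI)
  fix \<pi> assume \<pi>: "\<pi> \<in> avoiders {1..n + 2} {1}"
  then have \<pi>': "\<pi> \<in> avoiders {1..n + 2} {}" and "\<pi> 1 \<noteq> 1" and p: "\<pi> permutes {1..n + 2}"
    and inv: "\<And>i. \<pi> (\<pi> i) = i"
    by (auto simp: avoiders_def)
  define k where "k = \<pi> 1"
  have "k \<in> {1..n + 2}" unfolding k_def using p by (subst permutes_in_image) auto
  then have k: "1 < k" "k \<le> n + 2" using \<open>\<pi> 1 \<noteq> 1\<close> by (auto simp: k_def)
  define P where "P i \<longleftrightarrow> 2 \<le> i \<and> (i = k \<or> k < \<pi> i)" for i
  define l where "l = (LEAST i. P i)"
  have Pk: "P k" using k by (simp add: P_def)
  have Pl: "P l" unfolding l_def by (rule LeastI[of P, OF Pk])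
  have lk: "l \<le> k" unfolding l_def by (rule Least_le[of P, OF Pk])
  have l2: "2 \<le> l" using Pl by (simp add: P_def)
  have lo: "\<pi> i < k" if "i \<in> {2..<l}" for i
  proof -
    have "\<not> P i" using that unfolding l_def by (intro not_less_Least) simp
    moreover have "\<pi> i \<noteq> k" using inv[of i] inv[of 1] that unfolding k_def by force
    ultimately show ?thesis using that by (simp add: P_def)
  qed
  have hi: "k < \<pi> i" if "i \<in> {l..<k}" for i
  proof -
    have "k < \<pi> l" using Pl that by (auto simp: P_def)
    then show ?thesis
      using first_cycle_structure(1)[OF \<pi>' k_def[symmetric] k(1), of l i] that l2
      by (cases "i = l") auto
  qed
  have "l - 2 + (k - l) + 2 = k" "l - 2 + 1 = l - 1" using l2 lk by auto
  then have "\<pi> \<in> first_cycle_class n (l - 2) (k - l)"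
    unfolding first_cycle_class_def using \<pi>' lo hi l2 lk k_def by auto
  moreover have "(l - 2, k - l) \<in> Sigma {..n} (\<lambda>r. {..n - r})" using l2 lk k by auto
  ultimately show "\<pi> \<in> (\<Union>(r, m)\<in>Sigma {..n} (\<lambda>r. {..n - r}). first_cycle_class n r m)" by blast
next
  fix \<pi> assume "\<pi> \<in> (\<Union>(r, m)\<in>Sigma {..n} (\<lambda>r. {..n - r}). first_cycle_class n r m)"
  then show "\<pi> \<in> avoiders {1..n + 2} {1}" by (auto simp: first_cycle_class_def avoiders_def)
qed

text \<open>
If two classes share \<open>k\<close> and \<open>r < r'\<close>, the value in position \<open>r + 2\<close> would be both above and below \<open>k\<close>.
\<close>
lemma first_cycle_class_unique:
  assumes "\<pi> \<in> first_cycle_class n r m" "\<pi> \<in> first_cycle_class n r' m'"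
  shows "r = r'" "m = m'"
proof -
  have sum: "r + m = r' + m'" using assms by (simp add: first_cycle_class_def)
  have le: "r' \<le> r" if "\<pi> \<in> first_cycle_class n r m" "\<pi> \<in> first_cycle_class n r' m'" "r + m = r' + m'"
    for r m r' m'
  proof (rule ccontr)
    assume "\<not> r' \<le> r"
    then have "r + 2 \<in> {2..r' + 1}" "r + 2 \<in> {r + 2..r + m + 1}" using that(3) by auto
    then have "\<pi> (r + 2) < r' + m' + 2" "r + m + 2 < \<pi> (r + 2)"
      using that unfolding first_cycle_class_def by blast+
    then show False using that(3) by simp
  qed
  from le[OF assms sum] le[OF assms(2,1) sum[symmetric]] show "r = r'" by simp
  with sum show "m = m'" by simp
qed

lemma finite_first_cycle_class: "finite (first_cycle_class n r m)"
  by (simp add: first_cycle_class_def finite_avoiders)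

lemma card_first_cycle_class_eq:
  "r + m \<le> n \<Longrightarrow> card (first_cycle_class n r m) = num_layered r * num_increasing (n - r) m"
proof -
  assume "r + m \<le> n"
  moreover have "{2..r + 1} = {1 + 1..1 + r}" by auto
  ultimately show ?thesis
    unfolding num_increasing_def using card_first_cycle_class card_layered by metis
qed

lemma num_increasing_1:
  "num_increasing (n + 2) 1 = (\<Sum>r\<le>n. num_layered r * (\<Sum>m\<le>n - r. num_increasing (n - r) m))"
proof -
  have "num_increasing (n + 2) 1 = card (avoiders {1..n + 2} {1})"
    by (simp add: num_increasing_def)
  also have "\<dots> = (\<Sum>p\<in>Sigma {..n} (\<lambda>r. {..n - r}). card (case_prod (first_cycle_class n) p))"
    unfolding avoiders_first_not_fixed
  proof (rule card_UN_disjoint)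
    show "\<forall>p\<in>Sigma {..n} (\<lambda>r. {..n - r}). \<forall>q\<in>Sigma {..n} (\<lambda>r. {..n - r}). p \<noteq> q \<longrightarrow>
        case_prod (first_cycle_class n) p \<inter> case_prod (first_cycle_class n) q = {}"
      using first_cycle_class_unique by fast
  qed (auto simp: finite_first_cycle_class)
  also have "\<dots> = (\<Sum>r\<le>n. \<Sum>m\<le>n - r. card (first_cycle_class n r m))"
    by (simp add: sum.Sigma case_prod_beta)
  also have "\<dots> = (\<Sum>r\<le>n. \<Sum>m\<le>n - r. num_layered r * num_increasing (n - r) m)"
    by (intro sum.cong refl card_first_cycle_class_eq) auto
  finally show ?thesis by (simp add: sum_distrib_left)
qed

text \<open>
A layered part would start in position \<open>2\<close> with a value below \<open>\<pi> 1\<close>, so an initial ascent forces \<open>r = 0\<close>. When \<open>r = 0\<close>, the run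
begins with \<open>k = j + 2\<close> and continues through the \<open>j\<close> increasing large values, up to position \<open>k - 1\<close>. Hence
the condition on \<open>{1..m}\<close> means \<open>m \<le> j + 1\<close>.
\<close>
lemma avoiders_two_or_more_increasing:
  assumes m: "2 \<le> m"
  shows "avoiders {1..n + 2} {1..m} = (\<Union>j\<in>{m - 1..n}. first_cycle_class n 0 j)"
proof (intro equalityI subsetI)
  fix \<pi> assume "\<pi> \<in> avoiders {1..n + 2} {1..m}"
  then have \<pi>: "\<pi> \<in> avoiders {1..n + 2} {}" and p: "\<pi> permutes {1..n + 2}"
    and incr: "\<And>i j. i \<in> {1..m} \<Longrightarrow> j \<in> {1..m} \<Longrightarrow> i < j \<Longrightarrow> \<pi> i < \<pi> j"
    and out: "\<And>i. i \<in> {1..m} \<Longrightarrow> \<pi> i \<notin> {1..m}"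
    unfolding avoiders_def by blast+
  define k where "k = \<pi> 1"
  have "k \<in> {1..n + 2}" unfolding k_def using p by (subst permutes_in_image) auto
  then have k: "m < k" "k \<le> n + 2" using out[of 1] m by (auto simp: k_def)
  have "k < \<pi> 2" unfolding k_def by (rule incr) (use m in auto)
  then have "k < \<pi> i" if "i \<in> {2..k - 1}" for i
    using first_cycle_structure(1)[OF \<pi> k_def[symmetric], of 2 i] that k m by (cases "i = 2") auto
  moreover have "k - 2 + 2 = k" using k m by simp
  ultimately have "\<pi> \<in> first_cycle_class n 0 (k - 2)"
    using \<pi> k m unfolding first_cycle_class_def by (auto simp: k_def)
  then show "\<pi> \<in> (\<Union>j\<in>{m - 1..n}. first_cycle_class n 0 j)"
    by (rule UN_I[rotated]) (use k in auto)
next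
  fix \<pi> assume "\<pi> \<in> (\<Union>j\<in>{m - 1..n}. first_cycle_class n 0 j)"
  then obtain j where j: "m - 1 \<le> j" and "\<pi> \<in> first_cycle_class n 0 j" by auto
  then have \<pi>: "\<pi> \<in> avoiders {1..n + 2} {}" and \<pi>1: "\<pi> 1 = j + 2"
    and hi: "\<And>i. i \<in> {2..j + 1} \<Longrightarrow> j + 2 < \<pi> i"
    by (auto simp: first_cycle_class_def)
  have "\<pi> i < \<pi> i'" if i: "i \<in> {1..m}" "i' \<in> {1..m}" "i < i'" for i i'
  proof (cases "i = 1")
    case True
    then show ?thesis using hi[of i'] \<pi>1 i j by simp
  next
    case False
    show ?thesis
      by (rule first_cycle_structure(2)[OF \<pi> \<pi>1]) (use False i j hi in auto)
  qed
  moreover have "\<pi> i \<notin> {1..m}" if i: "i \<in> {1..m}" for i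
  proof (cases "i = 1")
    case False
    then have "j + 2 < \<pi> i" using i j by (intro hi) auto
    then show ?thesis using j by simp
  qed (use \<pi>1 j in simp)
  ultimately show "\<pi> \<in> avoiders {1..n + 2} {1..m}"
    using \<pi> unfolding avoiders_def by blast
qed

lemma num_increasing_ge_2:
  assumes "2 \<le> m"
  shows "num_increasing (n + 2) m = (\<Sum>j=m - 1..n. num_increasing n j)"
proof -
  have "num_increasing (n + 2) m = card (\<Union>j\<in>{m - 1..n}. first_cycle_class n 0 j)"
    unfolding num_increasing_def avoiders_two_or_more_increasing[OF assms] ..
  also have "\<dots> = (\<Sum>j=m - 1..n. card (first_cycle_class n 0 j))"
    by (rule card_UN_disjoint) (use first_cycle_class_unique(2) in \<open>auto simp: finite_first_cycle_class\<close>)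
  also have "\<dots> = (\<Sum>j=m - 1..n. num_increasing n j)"
    by (intro sum.cong refl) (simp add: card_first_cycle_class_eq num_layered_def)
  finally show ?thesis .
qed

section \<open>Generating functions\<close>

definition increasing_gf :: "nat \<Rightarrow> real fps" where
  "increasing_gf m = Abs_fps (\<lambda>n. real (num_increasing n m))"

definition layered_gf :: "real fps" where
  "layered_gf = Abs_fps (\<lambda>r. real (num_layered r))"

lemma layered_gf_eq: "layered_gf * (1 - 2 * fps_X) = 1 - fps_X"
proof (rule fps_ext)
  fix n
  have "layered_gf * (1 - 2 * fps_X) = layered_gf - fps_const 2 * (fps_X * layered_gf)"
    by (simp add: algebra_simps numeral_fps_const)
  then show "fps_nth (layered_gf * (1 - 2 * fps_X)) n = fps_nth (1 - fps_X) n"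
    by (cases n rule: nat.exhaust; cases "n - 1")
       (auto simp: layered_gf_def num_layered_def)
qed

lemma increasing_gf_0: "increasing_gf 0 = 1 + fps_X * increasing_gf 0 + increasing_gf 1"
proof (rule fps_ext)
  fix n
  show "fps_nth (increasing_gf 0) n = fps_nth (1 + fps_X * increasing_gf 0 + increasing_gf 1) n"
    by (cases n)
       (simp_all add: increasing_gf_def num_increasing_0_0 num_increasing_eq_0 num_increasing_Suc_0
         del: One_nat_def)
qed

text \<open>
The difference of the sums in \<open>num_increasing_ge_2\<close> for \<open>m\<close> and \<open>m + 1\<close> is their first term.
\<close>
lemma increasing_gf_step:
  assumes m: "2 \<le> m"
  shows "increasing_gf m = increasing_gf (m + 1) + fps_X ^ 2 * increasing_gf (m - 1)"
proof (rule fps_ext)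
  fix n
  show "fps_nth (increasing_gf m) n =
    fps_nth (increasing_gf (m + 1) + fps_X ^ 2 * increasing_gf (m - 1)) n"
  proof (cases "n < 2")
    case True
    then show ?thesis using m by (simp add: increasing_gf_def num_increasing_eq_0 fps_X_power_mult_nth)
  next
    case False
    then obtain p where n: "n = p + 2" by (metis add.commute le_Suc_ex not_less)
    have "(\<Sum>j=m - 1..p. num_increasing p j) =
        num_increasing p (m - 1) + (\<Sum>j=m..p. num_increasing p j)"
    proof (cases "m - 1 \<le> p")
      case True
      then show ?thesis using m sum.atLeast_Suc_atMost[OF True, of "num_increasing p"] by simp
    qed (simp add: num_increasing_eq_0)
    then have "num_increasing n m = num_increasing n (m + 1) + num_increasing p (m - 1)"
      using num_increasing_ge_2[of m p] num_increasing_ge_2[of "m + 1" p] m n by simp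
    then show ?thesis using n by (simp add: increasing_gf_def fps_X_power_mult_nth)
  qed
qed

text \<open>
The inner sum over all \<open>m\<close> that convolves with the layered involutions is, apart from its term \<open>m = 0\<close>,
the one that gives \<open>num_increasing (n + 2) 2\<close>. This is how the second series enters.
\<close>
lemma increasing_gf_1: "increasing_gf 1 = layered_gf * (fps_X ^ 2 * increasing_gf 0 + increasing_gf 2)"
proof -
  define T where "T = Abs_fps (\<lambda>n. real (\<Sum>m\<le>n. num_increasing n m))"
  have "fps_X ^ 2 * increasing_gf 0 + increasing_gf 2 = fps_X ^ 2 * T"
  proof (rule fps_ext)
    fix n
    show "fps_nth (fps_X ^ 2 * increasing_gf 0 + increasing_gf 2) n = fps_nth (fps_X ^ 2 * T) n"
    proof (cases "n < 2")
      case True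
      then show ?thesis by (simp add: increasing_gf_def num_increasing_eq_0 fps_X_power_mult_nth)
    next
      case False
      then obtain p where n: "n = p + 2" by (metis add.commute le_Suc_ex not_less)
      have "(\<Sum>m\<le>p. num_increasing p m) = num_increasing p 0 + num_increasing n 2"
        using num_increasing_ge_2[of 2 p] n by (simp add: atMost_atLeast0 sum.atLeast_Suc_atMost)
      then show ?thesis
        using n by (simp add: increasing_gf_def T_def fps_X_power_mult_nth flip: of_nat_sum of_nat_add)
    qed
  qed
  moreover have "increasing_gf 1 = fps_X ^ 2 * (layered_gf * T)"
  proof (rule fps_ext)
    fix n
    show "fps_nth (increasing_gf 1) n = fps_nth (fps_X ^ 2 * (layered_gf * T)) n"
    proof (cases "n < 2")
      case True
      then consider "n = 0" | "n = 1" by linarith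
      then show ?thesis
        using num_increasing_eq_0[of 0 1] num_increasing_1_1
        by cases (simp_all add: increasing_gf_def fps_X_power_mult_nth)
    next
      case False
      then obtain p where n: "n = p + 2" by (metis add.commute le_Suc_ex not_less)
      have "real (num_increasing n 1) = fps_nth (layered_gf * T) p"
        unfolding n num_increasing_1 by (simp add: fps_mult_nth layered_gf_def T_def atMost_atLeast0)
      then show ?thesis using n by (simp add: increasing_gf_def fps_X_power_mult_nth)
    qed
  qed
  ultimately show ?thesis by (simp add: algebra_simps)
qed

text \<open>
The root without constant term of \<open>t - t\<^sup>2 = x\<^sup>2\<close>, the characteristic equation of \<open>increasing_gf_step\<close>.
\<close>
definition small_root :: "real fps" where
  "small_root = fps_const (1 / 2) * (1 - sqrt_series)"

lemma two_small_root: "2 * small_root = 1 - sqrt_series"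
  by (simp add: small_root_def numeral_fps_const flip: mult.assoc)

lemma small_root_eq: "small_root * (1 - small_root) = fps_X ^ 2"
proof -
  have "4 * (small_root * (1 - small_root)) = 2 * small_root * (2 - 2 * small_root)"
    by (simp add: algebra_simps)
  also have "\<dots> = 1 - sqrt_series ^ 2"
    unfolding two_small_root by (simp add: algebra_simps power2_eq_square)
  also have "\<dots> = 4 * fps_X ^ 2" by (simp add: sqrt_series_square)
  finally show ?thesis by simp
qed

text \<open>
The roots of the characteristic equation are \<open>small_root\<close> and \<open>1 - small_root\<close>, so the defect \<open>D m\<close> of the claimed
geometric progression is itself geometric with ratio \<open>1 - small_root\<close>. This ratio is invertible,
so all \<open>D m\<close> have the same order as \<open>D 1\<close>, whereas the order of \<open>D m\<close> tends to infinity. So \<open>D 1 = 0\<close>.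
\<close>
lemma increasing_gf_2: "increasing_gf 2 = small_root * increasing_gf 1"
proof -
  define D where "D m = increasing_gf (m + 1) - small_root * increasing_gf m" for m
  have step: "D (m + 1) = (1 - small_root) * D m" if "1 \<le> m" for m
  proof -
    have "increasing_gf (m + 2) = increasing_gf (m + 1) - small_root * (1 - small_root) * increasing_gf m"
      using increasing_gf_step[of "m + 1"] that by (simp add: small_root_eq)
    then show ?thesis by (simp add: D_def algebra_simps)
  qed
  have pow: "D (1 + j) = (1 - small_root) ^ j * D 1" for j
  proof (induction j)
    case (Suc j)
    then show ?case using step[of "1 + j"] by (simp add: mult.assoc)
  qed simp
  have "D 1 = 0"
  proof (rule ccontr)
    assume nz: "D 1 \<noteq> 0"
    define p where "p = subdegree (D 1)"
    have "fps_nth (1 - small_root) 0 = 1"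
      by (simp add: small_root_def sqrt_series_nth_0)
    define w where "w = (1 - small_root) ^ p"
    have w0: "fps_nth w 0 = 1"
      using \<open>fps_nth (1 - small_root) 0 = 1\<close> by (simp add: w_def fps_nth_power_0)
    have "w \<noteq> 0" using w0 by force
    moreover have "subdegree w = 0" using w0 by (intro subdegree_eq_0) simp
    ultimately have "w * D 1 \<noteq> 0" "subdegree (w * D 1) = p"
      using nz by (simp_all add: p_def)
    then have "fps_nth (D (1 + p)) p \<noteq> 0"
      unfolding pow w_def[symmetric] by (metis nth_subdegree_nonzero)
    moreover have "fps_nth (D (1 + p)) p = 0"
      by (simp add: D_def fps_mult_nth increasing_gf_def num_increasing_eq_0)
    ultimately show False by contradiction
  qed
  then show ?thesis by (simp add: D_def numeral_2_eq_2)
qed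

theorem theorem1:
  shows "Abs_fps (\<lambda>n. real (num_avoiding_involutions n)) =
    (2 - 5 * fps_X + fps_X ^ 2 - 2 * fps_X ^ 3 + fps_X * (1 - fps_X) * sqrt_series) /
    (2 * (1 - fps_X) * (1 - 2 * fps_X - fps_X ^ 2 - 2 * fps_X ^ 3))"
proof -
  let ?X = "fps_X :: real fps"
  define F where "F = increasing_gf 0"
  define G where "G = increasing_gf 1"
  define s where "s = sqrt_series"
  define P where "P = 1 - 3 * ?X - 2 * ?X ^ 2"
  have F: "Abs_fps (\<lambda>n. real (num_avoiding_involutions n)) = F"
    by (simp add: F_def increasing_gf_def num_increasing_def num_avoiding_involutions_eq_card_avoiders)
  have s: "s ^ 2 = 1 - 4 * ?X ^ 2" by (simp add: s_def sqrt_series_square)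
  have F_G: "F * (1 - ?X) = 1 + G"
    using increasing_gf_0 by (simp add: F_def G_def algebra_simps)
  have "G * (1 - 2 * ?X) = layered_gf * (?X ^ 2 * F + small_root * G) * (1 - 2 * ?X)"
    using increasing_gf_1 unfolding increasing_gf_2 F_def G_def by (rule arg_cong)
  also have "\<dots> = layered_gf * (1 - 2 * ?X) * (?X ^ 2 * F + small_root * G)"
    by (simp only: ac_simps)
  finally have "G * (1 - 2 * ?X) = (1 - ?X) * (?X ^ 2 * F + small_root * G)"
    unfolding layered_gf_eq .
  then have "2 * (G * (1 - 2 * ?X)) = (1 - ?X) * (2 * ?X ^ 2 * F + 2 * small_root * G)"
    by algebra
  then have G_eq: "2 * (G * (1 - 2 * ?X)) = (1 - ?X) * (2 * ?X ^ 2 * F + (1 - s) * G)"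
    unfolding two_small_root s_def .
  \<comment> \<open>Elimination of \<open>G\<close> leaves a formula for \<open>F\<close> with \<open>s\<close> in the denominator, which is removed by multiplication with the conjugate.\<close>
  have lin: "F * (1 - ?X) * (P + (1 - ?X) * s) = 1 - 3 * ?X + (1 - ?X) * s"
    using F_G G_eq unfolding P_def by algebra
  have "F * (1 - ?X) * ((P + (1 - ?X) * s) * (P - (1 - ?X) * s)) =
      (1 - 3 * ?X + (1 - ?X) * s) * (P - (1 - ?X) * s)"
    using lin by algebra
  also have "(P + (1 - ?X) * s) * (P - (1 - ?X) * s) =
      - 4 * ?X * (1 - 2 * ?X - ?X ^ 2 - 2 * ?X ^ 3)"
    using s unfolding P_def by algebra
  also have "(1 - 3 * ?X + (1 - ?X) * s) * (P - (1 - ?X) * s) =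
      - 2 * ?X * (2 - 5 * ?X + ?X ^ 2 - 2 * ?X ^ 3 + ?X * (1 - ?X) * s)"
    using s unfolding P_def by algebra
  finally have "(- 2 * ?X) * (F * (2 * (1 - ?X) * (1 - 2 * ?X - ?X ^ 2 - 2 * ?X ^ 3))) =
      (- 2 * ?X) * (2 - 5 * ?X + ?X ^ 2 - 2 * ?X ^ 3 + ?X * (1 - ?X) * s)"
    by algebra
  \<comment> \<open>Both sides carry the factor \<open>- 2 * ?X\<close>, which the conjugate has introduced.\<close>
  then have eq: "F * (2 * (1 - ?X) * (1 - 2 * ?X - ?X ^ 2 - 2 * ?X ^ 3)) =
      2 - 5 * ?X + ?X ^ 2 - 2 * ?X ^ 3 + ?X * (1 - ?X) * s"
    by (subst (asm) mult_cancel_left) simp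
  have "fps_nth (2 * (1 - ?X) * (1 - 2 * ?X - ?X ^ 2 - 2 * ?X ^ 3)) 0 \<noteq> 0"
    by simp
  then have "2 * (1 - ?X) * (1 - 2 * ?X - ?X ^ 2 - 2 * ?X ^ 3) \<noteq> 0"
    by (metis fps_zero_nth)
  then show ?thesis
    unfolding F s_def[symmetric] eq[symmetric] by simp
qed

end
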